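(* Let $ABC$ be a triangle with incenter $I$. Let $\omega_a$ be a circle tangent to the sides $AB$ and $AC$ (possibly to their extensions, as specified in the configurations below), and let $\Omega$ be a circle passing through $B$ and $C$ and tangent to $\omega_a$. Let $k$ be a line tangent to $\omega_a$, and let $\omega$ be a circle tangent to the segment $BC$ at a point $D$, tangent to $\Omega$, and tangent to the line $k$ at a point $E$. Assume that $\omega$ lies on the same side of line $BC$ as $A$ and that the objects are in one of the following two configurations: (1) $\omega_a$ lies on the opposite side of line $AC$ from $B$ (so that it touches the lines $AB$ and $AC$ at points of the extensions of the sides $AB$ and $AC$ beyond $A$), the circle $\Omega$ is internally tangent to $\omega_a$, and $\omega$ lies on the same side of $k$ as $\omega_a$; (2) $\omega_a$ lies on the same side of line $AC$ as $B$ (so that it touches the sides $AB$ and $AC$ themselves), the circle $\Omega$ is externally tangent to $\omega_a$, and $\omega$ lies on the opposite side of $k$ from $\omega_a$. Then, for any choice of the line $k$, the line $DE$ passes through the fixed point $I$, the incenter of triangle $ABC$.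
   Context: The circle $\omega_a$, the points $B,C$ and the circle $\Omega$ are fixed, while the tangent line $k$ to $\omega_a$ (and with it $\omega$, $D$, $E$) varies. In configuration (1), $\omega_a$ lies inside $\Omega$. The two configurations are a description of the requirement that the circles and lines involved can be oriented so that all tangencies hold in the sense of Laguerre geometry, i.e. two tangent objects are tangent in the Euclidean sense and are directed the same way at the point of tangency.
   Formalization: Added hypothesis: the tangency points of ω with Ω and of ω_a with k are not strictly on opposite sides of line DE. Without it the claim fails: reflecting k in the line of centres of ω and ω_a keeps all hypotheses but moves E, and DE then misses I. *)

theory Defs
  imports "HOL-Analysis.Analysis"
begin

text \<open>
  The Euclidean plane is \<^typ>\<open>real^2\<close>. A circle is \<^term>\<open>sphere c r\<close> with an explicit
  hypothesis \<^prop>\<open>r > 0\<close>.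
\<close>

abbreviation line_through :: "real^2 \<Rightarrow> real^2 \<Rightarrow> (real^2) set" where
  "line_through P Q \<equiv> affine hull {P, Q}"

definition is_line :: "(real^2) set \<Rightarrow> bool" where
  "is_line l \<longleftrightarrow> (\<exists>P Q. P \<noteq> Q \<and> l = line_through P Q)"

text \<open>
  Used for a circle and a line, and for two circles. Since the radii are positive, having exactly
  one common point is tangency in the usual sense.
\<close>

definition tangent_at :: "(real^2) set \<Rightarrow> (real^2) set \<Rightarrow> real^2 \<Rightarrow> bool" where
  "tangent_at S T P \<longleftrightarrow> S \<inter> T = {P}"

text \<open>The first circle lies inside the second one.\<close>

definition internally_tangent :: "real^2 \<Rightarrow> real \<Rightarrow> real^2 \<Rightarrow> real \<Rightarrow> bool" where
  "internally_tangent c r d s \<longleftrightarrow>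
     (\<exists>P. tangent_at (sphere c r) (sphere d s) P) \<and> cball c r \<subseteq> cball d s"

definition externally_tangent :: "real^2 \<Rightarrow> real \<Rightarrow> real^2 \<Rightarrow> real \<Rightarrow> bool" where
  "externally_tangent c r d s \<longleftrightarrow>
     (\<exists>P. tangent_at (sphere c r) (sphere d s) P) \<and> ball c r \<inter> ball d s = {}"

text \<open>
  Sides of a line are closed half-planes, so that a circle tangent to the line also lies on one of
  its sides. Both predicates are false if \<open>l\<close> is not a line.
\<close>

definition same_side :: "(real^2) set \<Rightarrow> (real^2) set \<Rightarrow> (real^2) set \<Rightarrow> bool" where
  "same_side l S T \<longleftrightarrow>
     (\<exists>n b. n \<noteq> 0 \<and> l = {x. n \<bullet> x = b} \<and> (\<forall>x\<in>S. n \<bullet> x \<le> b) \<and> (\<forall>x\<in>T. n \<bullet> x \<le> b))"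

definition opposite_side :: "(real^2) set \<Rightarrow> (real^2) set \<Rightarrow> (real^2) set \<Rightarrow> bool" where
  "opposite_side l S T \<longleftrightarrow>
     (\<exists>n b. n \<noteq> 0 \<and> l = {x. n \<bullet> x = b} \<and> (\<forall>x\<in>S. n \<bullet> x \<le> b) \<and> (\<forall>x\<in>T. n \<bullet> x \<ge> b))"

definition is_incenter :: "real^2 \<Rightarrow> real^2 \<Rightarrow> real^2 \<Rightarrow> real^2 \<Rightarrow> bool" where
  "is_incenter I A B C \<longleftrightarrow>
     I \<in> interior (convex hull {A, B, C}) \<and>
     (\<exists>\<rho>>0. (\<exists>P. tangent_at (sphere I \<rho>) (line_through B C) P) \<and>
            (\<exists>P. tangent_at (sphere I \<rho>) (line_through C A) P) \<and>
            (\<exists>P. tangent_at (sphere I \<rho>) (line_through A B) P))"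

end

theory Submission
  imports Defs
begin

text \<open>
  Give \<open>\<omega>\<^sub>a\<close> the signed radius \<open>s = ra\<close> in configuration (1) and \<open>s = - ra\<close> in configuration (2).
  Oriented in this way, both configurations satisfy the same equations: the distance of the
  centres of \<open>\<omega>\<^sub>a\<close> and \<open>\<Omega>\<close> is \<open>R - s\<close>, the centre of \<open>\<omega>\<^sub>a\<close> has signed distance \<open>- s\<close> from \<open>AB\<close> and \<open>AC\<close>
  (where \<open>I\<close> has distance \<open>\<rho>\<close>), and a unit normal \<open>n\<close> of \<open>k\<close> satisfies \<open>E = w + r n\<close> and
  \<open>F = a + s n\<close>. In coordinates with \<open>BC\<close> as first axis and its midpoint as origin, these equations
  determine \<open>\<omega>\<^sub>a\<close> from \<open>I\<close> and \<open>\<Omega>\<close>, and \<open>\<omega>\<close> from \<open>D\<close>. The condition that \<open>k\<close> touches both circles then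
  becomes a quadratic equation for the slope of \<open>DE\<close> that splits into linear factors. One of them
  says that \<open>I\<close> lies on \<open>DE\<close>; the other one puts \<open>T\<close> and \<open>F\<close> on different sides of \<open>DE\<close>.
\<close>

section \<open>The equations in coordinates\<close>

text \<open>Here \<open>I = (x, \<rho>)\<close>, \<open>B = (- m, 0)\<close>, \<open>C = (m, 0)\<close>, \<open>\<omega>\<^sub>a\<close> has centre \<open>(a1, a2)\<close> and signed
  radius \<open>s\<close>, \<open>P = a2 + s\<close>, \<open>Q = a2 - s\<close>, \<open>\<Omega>\<close> has centre \<open>(0, h)\<close> and radius \<open>R\<close>, \<open>K = R - h\<close> and
  \<open>L = R + h\<close>. Eliminating \<open>P\<close> and \<open>a1\<close> leaves a quadratic equation in \<open>Q\<close>; its second root belongs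
  to a circle that lies entirely below \<open>BC\<close>.\<close>

lemma tangent_circle_coords:
  fixes m K L P Q a1 x \<rho> :: real
  assumes KL: "L * K = m\<^sup>2" and K: "K > 0" and \<rho>: "\<rho> > 0" and xm: "x\<^sup>2 < m\<^sup>2"
    and q1: "\<rho>\<^sup>2 * P + 2 * \<rho> * (x + m) * (a1 + m) = (x + m)\<^sup>2 * Q"
    and q2: "\<rho>\<^sup>2 * P + 2 * \<rho> * (m - x) * (m - a1) = (m - x)\<^sup>2 * Q"
    and tang: "a1\<^sup>2 + P * Q + K * P = L * Q + m\<^sup>2"
    and sgn: "P \<ge> 0 \<or> Q \<ge> 0"
  shows "K * P = m\<^sup>2 - x\<^sup>2" "K * a1 = x * (\<rho> + K)" "K * Q = \<rho> * (\<rho> + 2 * K)"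
proof -
  have m: "m \<noteq> 0" using xm by auto
  have "4 * m * (\<rho> * (x + a1)) = 4 * m * (x * Q)" using q1 q2 by algebra
  then have a1: "\<rho> * (x + a1) = x * Q" using m by simp
  have P: "\<rho>\<^sup>2 * P = (m\<^sup>2 - x\<^sup>2) * (Q - 2 * \<rho>)" using q1 q2 a1 by algebra
  have "(K * Q - \<rho> * (\<rho> + 2 * K)) * (m\<^sup>2 * Q + (m\<^sup>2 - x\<^sup>2) * K) = 0"
    using tang a1 P KL by algebra
  moreover have "m\<^sup>2 * Q + (m\<^sup>2 - x\<^sup>2) * K \<noteq> 0"
  proof
    assume *: "m\<^sup>2 * Q + (m\<^sup>2 - x\<^sup>2) * K = 0"
    have "(m\<^sup>2 - x\<^sup>2) * K > 0" using xm K by simp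
    then have "m\<^sup>2 * Q < 0" using * by linarith
    then have Q: "Q < 0" using m by (simp add: mult_less_0_iff)
    then have "\<rho>\<^sup>2 * P < 0" unfolding P using xm \<rho> by (intro mult_pos_neg) auto
    then have "P < 0" using \<rho> by (simp add: mult_less_0_iff)
    then show False using Q sgn by linarith
  qed
  ultimately show Q: "K * Q = \<rho> * (\<rho> + 2 * K)" by simp
  have "\<rho>\<^sup>2 * (K * P) = \<rho>\<^sup>2 * (m\<^sup>2 - x\<^sup>2)" using Q P by algebra
  then show "K * P = m\<^sup>2 - x\<^sup>2" using \<rho> by simp
  have "\<rho> * (K * a1) = \<rho> * (x * (\<rho> + K))" using Q a1 by algebra
  then show "K * a1 = x * (\<rho> + K)" using \<rho> by simp
qed

text \<open>The ratio \<open>g : H\<close> is the direction of \<open>DE\<close>. The tangency of \<open>k\<close> gives a quadratic equation for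
  it whose two roots are the two common tangents; for the wrong one the two factors in the
  hypothesis \<open>branch\<close> have opposite signs.\<close>

lemma chord_through_incenter:
  fixes m K P Q a1 x \<rho> d r g H :: real
  assumes K: "K > 0" and \<rho>: "\<rho> > 0"
    and P: "K * P = m\<^sup>2 - x\<^sup>2" and a1: "K * a1 = x * (\<rho> + K)" and Q: "K * Q = \<rho> * (\<rho> + 2 * K)"
    and r: "2 * r * K = m\<^sup>2 - d\<^sup>2"
    and quad: "g\<^sup>2 * Q - 2 * g * H * (a1 - d) + H\<^sup>2 * (2 * r - P) = 0"
    and branch: "(g * K - H * d) * (g * Q - H * (a1 - d)) \<ge> 0"
  shows "(x - d) * H = \<rho> * g"
proof -
  \<comment> \<open>The product is \<open>K\<close> times the left side of \<open>quad\<close> once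
    \<open>P\<close>, \<open>a1\<close>, \<open>Q\<close> and \<open>r\<close> are inserted.\<close>
  have "((\<rho> + 2 * K) * g - (x + d) * H) * (\<rho> * g - (x - d) * H) = 0"
    using quad P a1 Q r by algebra
  moreover have ?thesis if bad: "(\<rho> + 2 * K) * g = (x + d) * H"
  proof -
    \<comment> \<open>At the bad root the two factors of \<open>branch\<close> are
      \<open>- z\<close> and \<open>z\<close> up to positive multiples, so \<open>branch\<close>
      forces \<open>z = 0\<close>.\<close>
    define z where "z = H * (d * (\<rho> + K) - x * K)"
    have 1: "K * (g * Q - H * (a1 - d)) = z"
      unfolding z_def using bad a1 Q by algebra
    have 2: "(\<rho> + 2 * K) * (g * K - H * d) = - z"
      unfolding z_def using bad by algebra
    have "- (z * z) = (K * (g * Q - H * (a1 - d))) * ((\<rho> + 2 * K) * (g * K - H * d))"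
      unfolding 1 2 by simp
    also have "\<dots> = (K * (\<rho> + 2 * K)) * ((g * K - H * d) * (g * Q - H * (a1 - d)))"
      by (simp add: mult_ac)
    also have "\<dots> \<ge> 0" using K \<rho> branch by (intro mult_nonneg_nonneg[OF _ branch]) auto
    finally have "z = 0" by (simp add: mult_le_0_iff)
       (metis mult_eq_0_iff order_antisym zero_le_square)
    then have "g * K = H * d" using 2 K \<rho> by simp
    \<comment> \<open>With \<open>z = 0\<close> the bad root satisfies the other linear equation as
      well.\<close>
    then have "K * (\<rho> * g) = K * ((x - d) * H)"
      using \<open>z = 0\<close> unfolding z_def by algebra
    then show ?thesis using K by simp
  qed
  ultimately show ?thesis by auto
qed

text \<open>The origin is a vertex of the triangle, the first axis is one side through it and
  \<open>(v1, v2)\<close> is the unit normal of the other side; \<open>I = (p, \<rho>)\<close>, and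
  \<open>\<omega>\<^sub>a\<close> has centre \<open>(t, z)\<close>. As \<open>I\<close> has distance
  \<open>\<rho>\<close> from both sides, the normal is the mirror image of \<open>(0, 1)\<close> in
  the bisector, that is \<open>(2 \<rho> p, \<rho>^2 - p^2) / (\<rho>^2 + p^2)\<close>. Inserting it
  into \<open>a\<close> removes the unknown normal. The hypothesis \<open>v2\<close> excludes the
  first axis itself.\<close>

lemma second_tangent_normal:
  fixes p \<rho> v1 v2 t z s :: real
  assumes \<rho>: "\<rho> > 0" and v: "v1\<^sup>2 + v2\<^sup>2 = 1" and I: "v1 * p + v2 * \<rho> = \<rho>" and v2: "v2 \<noteq> 1"
    and a: "v1 * t + v2 * z = - s"
  shows "\<rho>\<^sup>2 * (z + s) + 2 * \<rho> * p * t = p\<^sup>2 * (z - s)"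
proof -
  have "(1 - v2) * ((1 + v2) * p\<^sup>2) = (1 - v2) * (\<rho>\<^sup>2 * (1 - v2))"
    using v I by algebra
  then have 1: "(1 + v2) * p\<^sup>2 = \<rho>\<^sup>2 * (1 - v2)" using v2 by simp
  have 2: "v1 * p = \<rho> * (1 - v2)" using I by (simp add: algebra_simps)
  have "(1 - v2) * (\<rho>\<^sup>2 * (z + s) + 2 * \<rho> * p * t - p\<^sup>2 * (z - s)) = 0"
    using 1 2 a v by algebra
  then show ?thesis using v2 by simp
qed

text \<open>Here \<open>\<omega>\<close> has centre \<open>(d, r)\<close>. Its point
  \<open>D = (d, 0)\<close> lies on the chord \<open>BC\<close> of \<open>\<Omega>\<close>, which
  rules out external tangency. The case \<open>r \<ge> R\<close> fails because
  \<open>\<omega>\<close> stays above \<open>BC\<close> while \<open>\<Omega>\<close> reaches below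
  it.\<close>

lemma circle_in_segment_coords:
  fixes m h R r d :: real
  assumes m: "m \<noteq> 0" and R: "R > 0" "R\<^sup>2 = m\<^sup>2 + h\<^sup>2" and r: "r > 0" and d: "d\<^sup>2 \<le> m\<^sup>2"
    and tang: "d\<^sup>2 + (r - h)\<^sup>2 = (R + r)\<^sup>2 \<or> d\<^sup>2 + (r - h)\<^sup>2 = (R - r)\<^sup>2"
  shows "R - h > 0" "r < R" "2 * r * (R - h) = m\<^sup>2 - d\<^sup>2" "d\<^sup>2 + (r - h)\<^sup>2 = (R - r)\<^sup>2"
proof -
  have "\<bar>h\<bar>\<^sup>2 < R\<^sup>2" using R m by simp
  then have h: "\<bar>h\<bar> < R" using R(1) power2_less_imp_less[of "\<bar>h\<bar>" R] by simp
  then show K: "R - h > 0" by linarith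
  show t: "d\<^sup>2 + (r - h)\<^sup>2 = (R - r)\<^sup>2"
  proof (rule ccontr)
    assume "d\<^sup>2 + (r - h)\<^sup>2 \<noteq> (R - r)\<^sup>2"
    then have "d\<^sup>2 + (r - h)\<^sup>2 = (R + r)\<^sup>2" using tang by blast
    then have "d\<^sup>2 - m\<^sup>2 = 2 * r * (R + h)" using R(2) by algebra
    moreover have "2 * r * (R + h) > 0" using r h by simp
    ultimately show False using d by linarith
  qed
  then show "2 * r * (R - h) = m\<^sup>2 - d\<^sup>2" using R(2) by algebra
  show "r < R"
  proof (rule ccontr)
    assume "\<not> r < R"
    then have "(r - R)\<^sup>2 < (r - h)\<^sup>2" using K by (intro power_strict_mono) auto
    also have "\<dots> \<le> (R - r)\<^sup>2" using t zero_le_power2[of d] by linarith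
    finally show False by (simp add: power2_commute)
  qed
qed

text \<open>Combines the determination of \<open>\<omega>\<^sub>a\<close> with the quadratic for the
  chord. The unit normals of \<open>k\<close> and \<open>DE\<close> are \<open>(g, g')\<close> and
  \<open>(p, q)\<close>; \<open>T\<close> and \<open>F\<close> express that the two contact points
  lie on the same side of \<open>DE\<close>.\<close>

lemma incenter_on_chord_coords:
  fixes m h R a1 a2 s x \<rho> d r g g' p q :: real
  assumes m: "m \<noteq> 0" and R: "R\<^sup>2 = m\<^sup>2 + h\<^sup>2" and K: "R - h > 0"
    and \<rho>: "\<rho> > 0" and xm: "x\<^sup>2 < m\<^sup>2"
    and AB: "\<rho>\<^sup>2 * (a2 + s) + 2 * \<rho> * (x + m) * (a1 + m) = (x + m)\<^sup>2 * (a2 - s)"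
    and AC: "\<rho>\<^sup>2 * (a2 + s) + 2 * \<rho> * (x - m) * (a1 - m) = (x - m)\<^sup>2 * (a2 - s)"
    and tang: "a1\<^sup>2 + (a2 - h)\<^sup>2 = (R - s)\<^sup>2" and sgn: "a2 + s \<ge> 0 \<or> a2 - s \<ge> 0"
    and r: "2 * r * (R - h) = m\<^sup>2 - d\<^sup>2"
    and unit: "g\<^sup>2 + g'\<^sup>2 = 1" "g' \<noteq> - 1" and k: "g * (a1 - d) + g' * (a2 - r) = r - s"
    and pq: "p\<^sup>2 + q\<^sup>2 = 1" "p * g + q * (1 + g') = 0"
    and T: "p * d + q * (R - h) \<le> 0" and F: "p * (a1 + s * g - d) + q * (a2 + s * g') \<le> 0"
  shows "(x - d) * (1 + g') = \<rho> * g"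
proof -
  define H where "H = 1 + g'"
  have "g'\<^sup>2 \<le> 1\<^sup>2" using unit(1) zero_le_power2[of g] unfolding power_one by linarith
  then have H: "H > 0" using unit(2) abs_le_square_iff[of g' 1] by (simp add: H_def abs_le_iff)
  have KL: "(R + h) * (R - h) = m\<^sup>2" using R by algebra
  have AC': "\<rho>\<^sup>2 * (a2 + s) + 2 * \<rho> * (m - x) * (m - a1) = (m - x)\<^sup>2 * (a2 - s)"
    using AC by algebra
  have tang': "a1\<^sup>2 + (a2 + s) * (a2 - s) + (R - h) * (a2 + s) = (R + h) * (a2 - s) + m\<^sup>2"
    using tang R by algebra
  note a = tangent_circle_coords[OF KL K \<rho> xm AB AC' tang' sgn]
  \<comment> \<open>Since \<open>g^2 = H * (2 - H)\<close>, the tangency condition \<open>k\<close>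
    can be made homogeneous in \<open>g\<close> and \<open>H\<close>.\<close>
  have quad: "g\<^sup>2 * (a2 - s) - 2 * g * H * (a1 - d) + H\<^sup>2 * (2 * r - (a2 + s)) = 0"
    using k unit(1) unfolding H_def by algebra
  have p: "p \<noteq> 0"
  proof
    assume "p = 0"
    then show False using pq H by (simp add: H_def)
  qed
  \<comment> \<open>Because \<open>p * g = - q * H\<close>, multiplying by \<open>p\<close> turns
    the two factors of the branch condition into \<open>- H\<close> times the left sides of
    \<open>T\<close> and \<open>F\<close>.\<close>
  have 1: "p * (g * (R - h) - H * d) = - H * (p * d + q * (R - h))"
    using pq(2) unfolding H_def by algebra
  have 2: "p * (g * (a2 - s) - H * (a1 - d)) = - H * (p * (a1 + s * g - d) + q * (a2 + s * g'))"
    using pq(2) unfolding H_def by algebra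
  have "(p * (g * (R - h) - H * d)) * (p * (g * (a2 - s) - H * (a1 - d))) \<ge> 0"
    unfolding 1 2 by (intro mult_nonneg_nonneg mult_nonpos_nonpos T F) (use H in auto)
  then have "p\<^sup>2 * ((g * (R - h) - H * d) * (g * (a2 - s) - H * (a1 - d))) \<ge> 0"
    by (simp add: power2_eq_square mult_ac)
  then have "(g * (R - h) - H * d) * (g * (a2 - s) - H * (a1 - d)) \<ge> 0"
    using p by (simp add: zero_le_mult_iff)
  from chord_through_incenter[OF K \<rho> a r quad this] show ?thesis by (simp add: H_def)
qed

section \<open>Lines and tangency in the plane\<close>

definition perp :: "real^2 \<Rightarrow> real^2" where
  "perp v = vector [- (v$2), v$1]"

lemma inner_real2: "x \<bullet> y = x$1 * y$1 + x$2 * y$2" for x y :: "real^2"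
  by (simp add: inner_vec_def sum_2)

lemma perp_component [simp]: "perp v $ 1 = - (v$2)" "perp v $ 2 = v$1"
  by (simp_all add: perp_def)

lemma inner_perp_self [simp]: "v \<bullet> perp v = 0" "perp v \<bullet> v = 0"
  by (simp_all add: inner_real2)

lemma inner_perp_perp: "perp u \<bullet> perp v = u \<bullet> v"
  by (simp add: inner_real2)

text \<open>A unit vector and its quarter turn form an orthonormal frame. With \<open>f\<close>
  normal to \<open>BC\<close> this provides the coordinates of the final proof.\<close>

lemma inner_frame:
  assumes "norm f = 1"
  shows "u \<bullet> v = (perp f \<bullet> u) * (perp f \<bullet> v) + (f \<bullet> u) * (f \<bullet> v)"
proof -
  have "f \<bullet> f = 1" using assms by (simp add: norm_eq_1)
  moreover have "(perp f \<bullet> u) * (perp f \<bullet> v) + (f \<bullet> u) * (f \<bullet> v) = (f \<bullet> f) * (u \<bullet> v)"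
    unfolding inner_real2 perp_component by algebra
  ultimately show ?thesis by simp
qed

lemma frame_eqI:
  assumes "norm f = 1" "perp f \<bullet> u = perp f \<bullet> v" "f \<bullet> u = f \<bullet> v"
  shows "u = v"
proof -
  have "(u - v) \<bullet> (u - v) = 0"
    using assms by (subst inner_frame[of f]) (auto simp: inner_diff_right)
  then show ?thesis by simp
qed

lemma line_through_eq_hyperplane:
  assumes "P \<noteq> Q"
  obtains n where "norm n = 1" "line_through P Q = {x. n \<bullet> x = n \<bullet> P}"
proof -
  define f where "f = (1 / norm (Q - P)) *\<^sub>R (Q - P)"
  have f: "norm f = 1" using assms by (simp add: f_def)
  have QP: "Q - P = norm (Q - P) *\<^sub>R f" using assms by (simp add: f_def)
  have n: "norm (perp f) = 1" using f by (simp add: norm_eq_1 inner_perp_perp)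
  have "x \<in> line_through P Q \<longleftrightarrow> perp f \<bullet> x = perp f \<bullet> P" for x
  proof
    assume "x \<in> line_through P Q"
    then obtain u v where "x = u *\<^sub>R P + v *\<^sub>R Q" "u + v = 1"
      unfolding affine_hull_2 by blast
    then have "x = (1 - v) *\<^sub>R P + v *\<^sub>R Q" by (simp add: eq_diff_eq[symmetric])
    then have "x - P = v *\<^sub>R (Q - P)" by (simp add: algebra_simps)
    then have "perp f \<bullet> (x - P) = 0" by (subst (asm) QP) simp
    then show "perp f \<bullet> x = perp f \<bullet> P" by (simp add: inner_diff_right)
  next
    assume "perp f \<bullet> x = perp f \<bullet> P"
    then have "x - P = (f \<bullet> (x - P)) *\<^sub>R f"
      using f by (intro frame_eqI[OF f]) (auto simp: inner_diff_right norm_eq_1)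
    also have "\<dots> = (f \<bullet> (x - P) / norm (Q - P)) *\<^sub>R (Q - P)"
      by (simp add: f_def)
    finally have "x = P + (f \<bullet> (x - P) / norm (Q - P)) *\<^sub>R (Q - P)" (is "_ = _ + ?t *\<^sub>R _")
      by (metis diff_add_cancel add.commute)
    then have "x = (1 - ?t) *\<^sub>R P + ?t *\<^sub>R Q" by (simp add: algebra_simps)
    then show "x \<in> line_through P Q" unfolding affine_hull_2
      by (smt (verit) mem_Collect_eq)
  qed
  with n that show ?thesis by blast
qed

lemma mem_line_through: "P \<in> line_through P Q" "Q \<in> line_through P Q"
  by (auto intro: hull_inc)

section \<open>Reflections and tangency\<close>

definition axis_reflection :: "real^2 \<Rightarrow> real^2 \<Rightarrow> real^2" where
  "axis_reflection n v = (2 * (n \<bullet> v)) *\<^sub>R n - v"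

lemma axis_reflection:
  assumes "norm n = 1"
  shows "n \<bullet> axis_reflection n v = n \<bullet> v"
    and "norm (axis_reflection n v) = norm v"
    and "norm (axis_reflection n v - t *\<^sub>R n) = norm (v - t *\<^sub>R n)"
    and "axis_reflection n v = v \<Longrightarrow> v = (n \<bullet> v) *\<^sub>R n"
proof -
  have nn: "n \<bullet> n = 1" using assms by (simp add: norm_eq_1)
  show 1: "n \<bullet> axis_reflection n v = n \<bullet> v"
    by (simp add: axis_reflection_def inner_diff_right nn)
  have 2: "axis_reflection n v \<bullet> axis_reflection n v = v \<bullet> v"
    by (simp add: axis_reflection_def inner_diff_left inner_diff_right nn inner_commute[of v n])
  then show "norm (axis_reflection n v) = norm v" by (simp add: norm_eq_sqrt_inner)
  have "(w - t *\<^sub>R n) \<bullet> (w - t *\<^sub>R n) = w \<bullet> w - 2 * t * (n \<bullet> w) + t * t" for w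
    by (simp add: inner_diff_left inner_diff_right nn inner_commute[of w n] algebra_simps)
  then show "norm (axis_reflection n v - t *\<^sub>R n) = norm (v - t *\<^sub>R n)"
    by (simp add: norm_eq_sqrt_inner 1 2)
  assume "axis_reflection n v = v"
  then have "2 *\<^sub>R v = 2 *\<^sub>R ((n \<bullet> v) *\<^sub>R n)"
    by (simp add: axis_reflection_def algebra_simps scaleR_2)
  then show "v = (n \<bullet> v) *\<^sub>R n" unfolding scaleR_cancel_left by simp
qed

lemma mem_sphere_norm: "x \<in> sphere a r \<longleftrightarrow> norm (x - a) = r" for x :: "real^2"
  by (simp add: dist_norm norm_minus_commute)

text \<open>Both tangency lemmas reflect the common point in the axis of symmetry.\<close>

lemma tangent_lineD:
  assumes "tangent_at (sphere a r) {x. n \<bullet> x = b} P" "norm n = 1"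
  shows "P = a + (b - n \<bullet> a) *\<^sub>R n" "\<bar>b - n \<bullet> a\<bar> = r" "n \<bullet> P = b"
proof -
  have P: "norm (P - a) = r" and nP: "n \<bullet> P = b"
    using assms(1) by (auto simp: tangent_at_def dist_norm norm_minus_commute)
  define v where "v = P - a"
  have nv: "n \<bullet> v = b - n \<bullet> a" using nP by (simp add: v_def inner_diff_right)
  have "a + axis_reflection n v \<in> sphere a r \<inter> {x. n \<bullet> x = b}"
    using P nv axis_reflection(1,2)[OF assms(2), of v]
    by (simp add: dist_norm v_def inner_add_right)
  then have "a + axis_reflection n v = P" using assms(1) unfolding tangent_at_def by blast
  then have "axis_reflection n v = v" by (simp add: v_def eq_diff_eq add.commute)
  note v = axis_reflection(4)[OF assms(2) this, unfolded nv]
  then show "P = a + (b - n \<bullet> a) *\<^sub>R n" by (simp add: v_def diff_eq_eq add.commute)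
  have "norm v = \<bar>b - n \<bullet> a\<bar>" using assms(2) by (subst v) simp
  then show "\<bar>b - n \<bullet> a\<bar> = r" using P by (simp add: v_def)
  show "n \<bullet> P = b" by fact
qed

lemma tangent_spheresD:
  assumes "tangent_at (sphere a r) (sphere c s) P" "r > 0"
  shows "a \<noteq> c" "\<exists>t. P = a + t *\<^sub>R (c - a)" "dist a c = s + r \<or> dist a c = \<bar>s - r\<bar>"
proof -
  have P: "norm (P - a) = r" "norm (P - c) = s"
    and uniq: "\<And>Q. norm (Q - a) = r \<Longrightarrow> norm (Q - c) = s \<Longrightarrow> Q = P"
    using assms(1) unfolding tangent_at_def set_eq_iff Int_iff mem_sphere_norm singleton_iff by blast+
  show "a \<noteq> c"
  proof
    assume ac: "a = c"
    \<comment> \<open>For concentric circles the antipode of \<open>P\<close> would be a second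
      common point.\<close>
    have "a - (P - a) = P"
      by (rule uniq) (use P ac in \<open>auto simp: norm_minus_commute\<close>)
    then have "2 *\<^sub>R (P - a) = 0" by (simp add: algebra_simps scaleR_2)
    then show False using P(1) assms(2) by simp
  qed
  define \<delta> where "\<delta> = norm (c - a)"
  have \<delta>: "\<delta> > 0" using \<open>a \<noteq> c\<close> by (simp add: \<delta>_def)
  define n where "n = (1 / \<delta>) *\<^sub>R (c - a)"
  have n: "norm n = 1" using \<delta> by (simp add: n_def \<delta>_def)
  have c: "c = a + \<delta> *\<^sub>R n" using \<delta> by (simp add: n_def)
  define v where "v = P - a"
  have Pc: "P - c = v - \<delta> *\<^sub>R n" by (simp add: c v_def)
  have "a + axis_reflection n v = P"
  proof (rule uniq)
    show "norm (a + axis_reflection n v - a) = r"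
      using P(1) axis_reflection(2)[OF n, of v] by (simp add: v_def)
    have "a + axis_reflection n v - c = axis_reflection n v - \<delta> *\<^sub>R n" by (simp add: c)
    then show "norm (a + axis_reflection n v - c) = s"
      using P(2) axis_reflection(3)[OF n, of v \<delta>] Pc by metis
  qed
  then have "axis_reflection n v = v" by (simp add: v_def eq_diff_eq add.commute)
  then obtain t where v: "v = t *\<^sub>R n" using axis_reflection(4)[OF n] by blast
  then have "P = a + (t / \<delta>) *\<^sub>R (c - a)"
    by (simp add: v_def n_def diff_eq_eq add.commute)
  then show "\<exists>t. P = a + t *\<^sub>R (c - a)" by blast
  have "r = \<bar>t\<bar>" using P(1) v n by (simp add: v_def)
  moreover have "P - c = (t - \<delta>) *\<^sub>R n" unfolding Pc v by (simp add: scaleR_diff_left)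
  then have "s = \<bar>t - \<delta>\<bar>" using P(2) n by simp
  moreover have "dist a c = \<delta>" by (simp add: \<delta>_def dist_norm norm_minus_commute)
  ultimately show "dist a c = s + r \<or> dist a c = \<bar>s - r\<bar>" using \<delta> by linarith
qed

text \<open>Tangency leaves the sum or the difference of the radii; inclusion of the discs leaves
  only the difference.\<close>

lemma internally_tangentD:
  assumes "internally_tangent c r d s" "r > 0" "s > 0"
  shows "dist c d = s - r"
proof -
  obtain P where "tangent_at (sphere c r) (sphere d s) P" and "cball c r \<subseteq> cball d s"
    using assms(1) by (auto simp: internally_tangent_def)
  from this(2) have "dist c d + r \<le> s"
    using assms(2) by (simp add: cball_subset_cball_iff)
  then show ?thesis
    using tangent_spheresD(3)[OF \<open>tangent_at _ _ P\<close> assms(2)] assms(2) by linarith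
qed

lemma externally_tangentD:
  assumes "externally_tangent c r d s" "r > 0" "s > 0"
  shows "dist c d = s + r"
proof -
  obtain P where P: "tangent_at (sphere c r) (sphere d s) P" and disj: "ball c r \<inter> ball d s = {}"
    using assms(1) by (auto simp: externally_tangent_def)
  have "dist c d \<ge> s + r"
  proof (rule ccontr)
    assume "\<not> s + r \<le> dist c d"
    then have *: "norm (d - c) < r + s" by (simp add: dist_norm norm_minus_commute)
    \<comment> \<open>If the centres were too close, the point dividing their segment in the ratio
      \<open>r : s\<close> would lie in both open discs.\<close>
    define t where "t = r / (r + s)"
    have t1: "t * (r + s) = r" and t0: "t > 0" "1 - t > 0" using assms(2,3) by (simp_all add: t_def)
    have t2: "(1 - t) * (r + s) = s" unfolding left_diff_distrib t1 by simp
    note t = t1 t2 t0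
    define x where "x = c + t *\<^sub>R (d - c)"
    have "norm (x - c) = t * norm (d - c)" using t by (simp add: x_def)
    also have "\<dots> < t * (r + s)" by (intro mult_strict_left_mono * t)
    finally have 1: "norm (x - c) < r" using t by simp
    have "d - x = (1 - t) *\<^sub>R (d - c)" by (simp add: x_def algebra_simps)
    then have "norm (d - x) = (1 - t) * norm (d - c)" using t by simp
    also have "\<dots> < (1 - t) * (r + s)" by (intro mult_strict_left_mono * t)
    finally have 2: "norm (d - x) < s" using t by simp
    have "x \<in> ball c r \<inter> ball d s" using 1 2 by (simp add: dist_norm norm_minus_commute)
    then show False using disj by simp
  qed
  then show ?thesis using tangent_spheresD(3)[OF P assms(2)] assms(2,3) by linarith
qed

section \<open>Half-planes and circles touching the sides of an angle\<close>

lemma same_sideE: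
  assumes "same_side l S T"
  obtains n b where "norm n = 1" "l = {x. n \<bullet> x = b}"
    "\<forall>x\<in>S. n \<bullet> x \<le> b" "\<forall>x\<in>T. n \<bullet> x \<le> b"
proof -
  obtain n b where n: "n \<noteq> 0" "l = {x. n \<bullet> x = b}" "\<forall>x\<in>S. n \<bullet> x \<le> b" "\<forall>x\<in>T. n \<bullet> x \<le> b"
    using assms unfolding same_side_def by blast
  show ?thesis
    by (rule that[of "(1 / norm n) *\<^sub>R n" "b / norm n"])
      (use n in \<open>auto simp: divide_right_mono\<close>)
qed

lemma opposite_sideE:
  assumes "opposite_side l S T"
  obtains n b where "norm n = 1" "l = {x. n \<bullet> x = b}"
    "\<forall>x\<in>S. n \<bullet> x \<le> b" "\<forall>x\<in>T. n \<bullet> x \<ge> b"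
proof -
  obtain n b where n: "n \<noteq> 0" "l = {x. n \<bullet> x = b}" "\<forall>x\<in>S. n \<bullet> x \<le> b" "\<forall>x\<in>T. n \<bullet> x \<ge> b"
    using assms unfolding opposite_side_def by blast
  show ?thesis
    by (rule that[of "(1 / norm n) *\<^sub>R n" "b / norm n"])
      (use n in \<open>auto simp: divide_right_mono\<close>)
qed

lemma sphere_center_le:
  assumes "\<forall>x\<in>sphere a r. n \<bullet> x \<le> b" "r \<ge> 0" "norm n = 1"
  shows "n \<bullet> a \<le> b"
proof -
  have "a + r *\<^sub>R n \<in> sphere a r" using assms(2,3) by (simp add: dist_norm)
  from assms(1) this have "n \<bullet> a + r \<le> b" using assms(3) by (force simp: inner_add_right norm_eq_1)
  then show ?thesis using assms(2) by linarith
qed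

lemma incircle_side_distance:
  assumes I: "I \<in> interior (convex hull {P, Q, S})"
    and t: "\<exists>Z. tangent_at (sphere I \<rho>) {x. n \<bullet> x = n \<bullet> P} Z"
    and n: "norm n = 1" and Q: "n \<bullet> Q = n \<bullet> P" and S: "n \<bullet> S > n \<bullet> P"
  shows "n \<bullet> (I - P) = \<rho>"
proof -
  have "convex hull {P, Q, S} \<subseteq> {x. n \<bullet> x \<ge> n \<bullet> P}"
    by (rule hull_minimal) (use Q S in \<open>auto intro: convex_halfspace_ge\<close>)
  then have "I \<in> interior {x. n \<bullet> x \<ge> n \<bullet> P}" using I interior_mono by blast
  then have "n \<bullet> I > n \<bullet> P" using n interior_halfspace_ge[of n "n \<bullet> P"] by fastforce
  moreover obtain Z where "tangent_at (sphere I \<rho>) {x. n \<bullet> x = n \<bullet> P} Z" using t by blast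
  from tangent_lineD(2)[OF this n] have "\<bar>n \<bullet> P - n \<bullet> I\<bar> = \<rho>" .
  ultimately show ?thesis by (simp add: inner_diff_right)
qed

text \<open>The point \<open>Y\<close> of the circle is on the far side of the line from
  \<open>C\<close>, since \<open>A\<close> separates them. A circle tangent to the line lies on one
  side of it, so its centre is on the far side too.\<close>

lemma tangent_opposite_angle:
  assumes "norm n = 1" "tangent_at (sphere a r) {x. n \<bullet> x = n \<bullet> A} X"
    and C: "n \<bullet> C > n \<bullet> A" and Y: "Y \<in> sphere a r" "A \<in> open_segment Y C"
  shows "n \<bullet> (a - A) = - r"
proof -
  have 1: "\<bar>n \<bullet> A - n \<bullet> a\<bar> = r" using tangent_lineD(2)[OF assms(2,1)] .
  have "\<bar>n \<bullet> (Y - a)\<bar> \<le> r"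
    using Cauchy_Schwarz_ineq2[of n "Y - a"] Y(1) assms(1) by (simp add: mem_sphere_norm del: mem_sphere)
  then have 2: "n \<bullet> Y \<ge> n \<bullet> a - r" by (simp add: inner_diff_right)
  obtain u where u: "0 < u" "u < 1" and A: "A = (1 - u) *\<^sub>R Y + u *\<^sub>R C"
    using Y(2) by (auto simp: in_segment)
  have "n \<bullet> A = (1 - u) * (n \<bullet> Y) + u * (n \<bullet> C)"
    by (subst A) (simp add: inner_add_right)
  then have "(1 - u) * (n \<bullet> A - n \<bullet> Y) = u * (n \<bullet> C - n \<bullet> A)" by algebra
  also have "\<dots> > 0" using u C by simp
  finally have "n \<bullet> A > n \<bullet> Y" using u by (simp add: zero_less_mult_iff)
  then show ?thesis using 1 2 by (simp add: inner_diff_right)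
qed

text \<open>If the circle were on the side away from \<open>C\<close>, its contact point
  \<open>Y\<close> on the ray from \<open>A\<close> to \<open>C\<close> could only be
  \<open>A\<close>. Then both lines touch the circle at \<open>A\<close>, so both are perpendicular
  to the same radius, although only one contains \<open>C\<close>.\<close>

lemma tangent_same_angle:
  assumes "norm n = 1" "tangent_at (sphere a r) {x. n \<bullet> x = n \<bullet> A} X"
    and "norm n' = 1" "tangent_at (sphere a r) {x. n' \<bullet> x = n' \<bullet> A} Y"
    and r: "r > 0" and C: "n \<bullet> C > n \<bullet> A" "n' \<bullet> C = n' \<bullet> A" and Y: "Y \<in> closed_segment A C"
  shows "n \<bullet> (a - A) = r"
proof (rule ccontr)
  assume "n \<bullet> (a - A) \<noteq> r"
  then have 1: "n \<bullet> a + r = n \<bullet> A"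
    using tangent_lineD(2)[OF assms(2,1)] by (simp add: inner_diff_right)
  have Ys: "Y \<in> sphere a r" using assms(4) by (auto simp: tangent_at_def)
  then have "\<bar>n \<bullet> (Y - a)\<bar> \<le> r"
    using Cauchy_Schwarz_ineq2[of n "Y - a"] assms(1) by (simp add: mem_sphere_norm del: mem_sphere)
  then have 2: "n \<bullet> Y \<le> n \<bullet> A" using 1 by (simp add: inner_diff_right)
  obtain u where u: "0 \<le> u" and YA: "Y = (1 - u) *\<^sub>R A + u *\<^sub>R C"
    using Y by (auto simp: in_segment)
  have "n \<bullet> Y = (1 - u) * (n \<bullet> A) + u * (n \<bullet> C)"
    by (subst YA) (simp add: inner_add_right)
  then have "n \<bullet> Y - n \<bullet> A = u * (n \<bullet> C - n \<bullet> A)" by algebra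
  then have "u * (n \<bullet> C - n \<bullet> A) \<le> 0" using 2 by linarith
  then have "u = 0" using u C(1) by (simp add: mult_le_0_iff)
  then have "Y = A" using YA by simp
  then have "A \<in> sphere a r \<inter> {x. n \<bullet> x = n \<bullet> A}" using Ys by simp
  then have "X = A" unfolding assms(2)[unfolded tangent_at_def] by simp
  have 3: "A - a = (n \<bullet> A - n \<bullet> a) *\<^sub>R n"
    using tangent_lineD(1)[OF assms(2,1)] unfolding \<open>X = A\<close> by (simp add: diff_eq_eq add.commute)
  have 4: "A - a = (n' \<bullet> A - n' \<bullet> a) *\<^sub>R n'"
    using tangent_lineD(1)[OF assms(4,3)] unfolding \<open>Y = A\<close> by (simp add: diff_eq_eq add.commute)
  have "(A - a) \<bullet> (C - A) = 0" by (subst 4) (simp add: inner_diff_right C)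
  moreover have "(A - a) \<bullet> (C - A) = r * (n \<bullet> C - n \<bullet> A)"
    by (subst 3) (simp add: inner_diff_right algebra_simps flip: 1)
  ultimately show False using r C by simp
qed

lemma side_normal:
  assumes "\<not> collinear {P, Q, S}"
  obtains n where "norm n = 1" "line_through P Q = {x. n \<bullet> x = n \<bullet> P}" "n \<bullet> Q = n \<bullet> P"
    "n \<bullet> S > n \<bullet> P"
proof -
  have "P \<noteq> Q" using assms by auto
  then obtain n where n: "norm n = 1" "line_through P Q = {x. n \<bullet> x = n \<bullet> P}"
    by (rule line_through_eq_hyperplane)
  have "S \<notin> line_through P Q" using assms \<open>P \<noteq> Q\<close> collinear_3_affine_hull by blast
  then have S: "n \<bullet> S \<noteq> n \<bullet> P" using n(2) by auto
  have Q: "n \<bullet> Q = n \<bullet> P" using n(2) mem_line_through(2)[of Q P] by auto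
  show ?thesis
  proof (cases "n \<bullet> S > n \<bullet> P")
    case True
    then show ?thesis using that n Q by blast
  next
    case False
    show ?thesis by (rule that[of "- n"]) (use n Q S False in auto)
  qed
qed

text \<open>Transfers the previous computation to the vertex \<open>P\<close> with \<open>f\<close>
  normal to \<open>PQ\<close> and \<open>n\<close> normal to the other side. The second claim places
  the foot of the perpendicular from \<open>I\<close> on the ray from \<open>P\<close> towards
  \<open>Q\<close>; used at both \<open>B\<close> and \<open>C\<close>, it puts that foot strictly
  inside \<open>BC\<close>.\<close>

lemma second_tangent_inner:
  assumes f: "norm f = 1" "f \<bullet> (I - P) = \<rho>" and n: "norm n = 1" "n \<bullet> (I - P) = \<rho>"
    and nf: "n \<noteq> f" and a: "n \<bullet> (a - P) = - s" and \<rho>: "\<rho> > 0"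
    and Q: "n \<bullet> (Q - P) > 0" "f \<bullet> (Q - P) = 0"
  defines "e \<equiv> perp f"
  shows "\<rho>\<^sup>2 * (f \<bullet> (a - P) + s) + 2 * \<rho> * (e \<bullet> (I - P)) * (e \<bullet> (a - P))
      = (e \<bullet> (I - P))\<^sup>2 * (f \<bullet> (a - P) - s)"
    and "(e \<bullet> (Q - P)) * (e \<bullet> (I - P)) > 0"
proof -
  note frame = inner_frame[OF f(1), folded e_def]
  have v: "(e \<bullet> n)\<^sup>2 + (f \<bullet> n)\<^sup>2 = 1"
    using frame[of n n] n(1) by (simp add: norm_eq_1 power2_eq_square)
  have v2: "f \<bullet> n \<noteq> 1"
  proof
    assume "f \<bullet> n = 1"
    moreover from this have "e \<bullet> n = 0" using v by simp
    ultimately have "n = f" using f(1) by (intro frame_eqI[OF f(1)]) (auto simp: norm_eq_1 e_def)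
    with nf show False by simp
  qed
  have I: "(e \<bullet> n) * (e \<bullet> (I - P)) + (f \<bullet> n) * \<rho> = \<rho>"
    using frame[of n "I - P"] n(2) f(2) by simp
  have a': "(e \<bullet> n) * (e \<bullet> (a - P)) + (f \<bullet> n) * (f \<bullet> (a - P)) = - s"
    using frame[of n "a - P"] a by simp
  show "\<rho>\<^sup>2 * (f \<bullet> (a - P) + s) + 2 * \<rho> * (e \<bullet> (I - P)) * (e \<bullet> (a - P))
      = (e \<bullet> (I - P))\<^sup>2 * (f \<bullet> (a - P) - s)"
    by (rule second_tangent_normal[OF \<rho> v I v2 a'])
  have "(f \<bullet> n)\<^sup>2 \<le> 1\<^sup>2" using v zero_le_power2[of "e \<bullet> n"] unfolding power_one by linarith
  then have "f \<bullet> n < 1" using v2 power2_le_imp_le[of "f \<bullet> n" 1] by simp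
  then have "\<rho> * (1 - f \<bullet> n) > 0" using \<rho> by simp
  then have "(e \<bullet> n) * (e \<bullet> (I - P)) > 0" using I by (simp add: algebra_simps)
  moreover have "(e \<bullet> n) * (e \<bullet> (Q - P)) > 0"
    using frame[of n "Q - P"] Q by simp
  ultimately show "(e \<bullet> (Q - P)) * (e \<bullet> (I - P)) > 0"
    by (auto simp: zero_less_mult_iff)
qed

lemma line_not_singleton:
  fixes n P :: "real^2"
  assumes "norm n = 1" "{x. n \<bullet> x = b} = {P}"
  shows False
proof -
  have "n \<bullet> P = b" using assms(2) by blast
  then have "P + perp n \<in> {x. n \<bullet> x = b}" by (simp add: inner_add_right)
  then have "perp n = 0" unfolding assms(2) by simp
  then have "n \<bullet> n = 0" using inner_perp_perp[of n n] by simp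
  then show False using assms(1) by simp
qed

(* Circles: omega_a = sphere a ra, Omega = sphere c R, omega = sphere w r.
   X, Y, F are the points where omega_a touches AB, AC, k; T is the point where omega touches
   Omega. The hypothesis "branch" selects which of the two common tangents of omega and omega_a
   (of the type prescribed by the configuration) is k: these two lines are mirror images in the
   line of centres and satisfy the same tangency and side conditions, but E differs and the
   line DE contains I for only one of them. *)
theorem theorem2p3:
  fixes A B C I a c w D E F T X Y :: "real^2"
    and ra R r :: real
    and k :: "(real^2) set"
  assumes triangle: "\<not> collinear {A, B, C}"
    and incenter: "is_incenter I A B C"
    and omega_a: "ra > 0"
      "tangent_at (sphere a ra) (line_through A B) X"
      "tangent_at (sphere a ra) (line_through A C) Y"
    and Omega: "R > 0" "B \<in> sphere c R" "C \<in> sphere c R"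
    and k: "is_line k" "tangent_at (sphere a ra) k F"
    and omega: "r > 0"
      "tangent_at (sphere w r) (line_through B C) D" "D \<in> closed_segment B C"
      "tangent_at (sphere w r) (sphere c R) T"
      "tangent_at (sphere w r) k E"
      "same_side (line_through B C) (sphere w r) {A}"
    and configuration:
      "(opposite_side (line_through A C) (sphere a ra) {B} \<and>
        A \<in> open_segment X B \<and> A \<in> open_segment Y C \<and>
        internally_tangent a ra c R \<and>
        same_side k (sphere w r) (sphere a ra))
       \<or>
       (same_side (line_through A C) (sphere a ra) {B} \<and>
        X \<in> closed_segment A B \<and> Y \<in> closed_segment A C \<and>
        externally_tangent a ra c R \<and>
        opposite_side k (sphere w r) (sphere a ra))"
    and branch: "same_side (line_through D E) {T} {F}"
  shows "D \<noteq> E \<and> I \<in> line_through D E"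
proof -
  have XY: "X \<in> sphere a ra" "Y \<in> sphere a ra"
    using omega_a(2,3) by (auto simp: tangent_at_def)

  \<comment> \<open>Inward unit normals of the sides and the inradius\<close>
  obtain n1 where n1: "norm n1 = 1" "line_through A B = {x. n1 \<bullet> x = n1 \<bullet> A}" "n1 \<bullet> B = n1 \<bullet> A"
    "n1 \<bullet> C > n1 \<bullet> A" using side_normal[OF triangle] .
  obtain n2 where n2: "norm n2 = 1" "line_through A C = {x. n2 \<bullet> x = n2 \<bullet> A}" "n2 \<bullet> C = n2 \<bullet> A"
    "n2 \<bullet> B > n2 \<bullet> A" using side_normal[of A C B] triangle by (auto simp: insert_commute)

  obtain f where f: "norm f = 1" "line_through B C = {x. f \<bullet> x = f \<bullet> B}" "f \<bullet> C = f \<bullet> B"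
    "f \<bullet> A > f \<bullet> B" and w: "f \<bullet> w - f \<bullet> B \<ge> 0"
  proof -
    obtain n b where n: "norm n = 1" "line_through B C = {x. n \<bullet> x = b}"
      "\<forall>x\<in>sphere w r. n \<bullet> x \<le> b" "\<forall>x\<in>{A}. n \<bullet> x \<le> b"
      using same_sideE[OF omega(6)] .
    from n(4) have A: "n \<bullet> A \<le> b" by simp
    have B: "n \<bullet> B = b" "n \<bullet> C = b" using n(2) mem_line_through[of B C] mem_line_through[of C B] by auto
    have "B \<noteq> C" using triangle by auto
    then have "A \<notin> line_through B C"
      using triangle collinear_3_affine_hull[of B C A] by (simp add: insert_commute)
    then have "n \<bullet> A < b" using n(2) A by auto
    moreover have "n \<bullet> w \<le> b" using sphere_center_le[OF n(3)] omega(1) n(1) by simp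
    ultimately show thesis using that[of "- n"] n(1,2) B by simp
  qed

  obtain \<rho> where \<rho>: "\<rho> > 0" and \<rho>1: "n1 \<bullet> (I - A) = \<rho>" and \<rho>2: "n2 \<bullet> (I - A) = \<rho>"
    and \<rho>f: "f \<bullet> (I - B) = \<rho>"
  proof -
    obtain \<rho> where \<rho>: "\<rho> > 0"
      and t: "\<exists>P. tangent_at (sphere I \<rho>) (line_through B C) P"
        "\<exists>P. tangent_at (sphere I \<rho>) (line_through A C) P"
        "\<exists>P. tangent_at (sphere I \<rho>) (line_through A B) P"
      using incenter by (auto simp: is_incenter_def insert_commute)
    have I: "I \<in> interior (convex hull {A, B, C})" "I \<in> interior (convex hull {A, C, B})"
      "I \<in> interior (convex hull {B, C, A})"
      using incenter by (auto simp: is_incenter_def insert_commute)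
    show thesis
      using that[OF \<rho>] incircle_side_distance[OF I(1) t(3)[unfolded n1(2)] n1(1,3,4)]
        incircle_side_distance[OF I(2) t(2)[unfolded n2(2)] n2(1,3,4)]
        incircle_side_distance[OF I(3) t(1)[unfolded f(2)] f(1,3,4)] by blast
  qed

  \<comment> \<open>From here on the configurations differ only in the sign of \<open>s\<close>. The
    position of \<open>X\<close> relative to \<open>BC\<close> is kept to exclude the spurious
    circle below \<open>BC\<close>.\<close>
  obtain s n where s: "\<bar>s\<bar> = ra" and a1: "n1 \<bullet> (a - A) = - s" and a2: "n2 \<bullet> (a - A) = - s"
    and ac: "dist a c = R - s" and X: "f \<bullet> X \<ge> f \<bullet> B"
    and n: "norm n = 1" and E: "E = w + r *\<^sub>R n" and F: "F = a + s *\<^sub>R n"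
    and naw: "n \<bullet> (a - w) = r - s"
    using configuration
  proof (elim disjE conjE)
    assume A: "A \<in> open_segment X B" "A \<in> open_segment Y C"
      and t: "internally_tangent a ra c R" and kk: "same_side k (sphere w r) (sphere a ra)"
    obtain n b where n: "norm n = 1" "k = {x. n \<bullet> x = b}" "\<forall>x\<in>sphere w r. n \<bullet> x \<le> b"
      "\<forall>x\<in>sphere a ra. n \<bullet> x \<le> b" using same_sideE[OF kk] .
    note E = tangent_lineD[OF omega(5)[unfolded n(2)] n(1)]
      and F = tangent_lineD[OF k(2)[unfolded n(2)] n(1)]
    have nw: "b - n \<bullet> w = r" "b - n \<bullet> a = ra"
      using E(2) F(2) sphere_center_le[OF n(3) _ n(1)] sphere_center_le[OF n(4) _ n(1)]
        omega(1) omega_a(1) by auto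
    obtain u where u: "0 < u" "u < 1" and A': "A = (1 - u) *\<^sub>R X + u *\<^sub>R B"
      using A(1) by (auto simp: in_segment)
    \<comment> \<open>As \<open>A\<close> lies between \<open>X\<close> and \<open>B\<close>, the
      point \<open>X\<close> is on the same side of \<open>BC\<close> as \<open>A\<close>.\<close>
    have "f \<bullet> A = (1 - u) * (f \<bullet> X) + u * (f \<bullet> B)" by (subst A') (simp add: inner_add_right)
    then have "(1 - u) * (f \<bullet> X - f \<bullet> B) = f \<bullet> A - f \<bullet> B" by algebra
    then have X: "f \<bullet> X > f \<bullet> B" using u f(4) by (smt (verit) mult_nonneg_nonpos)
    show thesis
    proof (rule that[of ra n])
      show "n1 \<bullet> (a - A) = - ra"
        using tangent_opposite_angle[OF n1(1) omega_a(2)[unfolded n1(2)] n1(4) XY(2) A(2)] .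
      show "n2 \<bullet> (a - A) = - ra"
        using tangent_opposite_angle[OF n2(1) omega_a(3)[unfolded n2(2)] n2(4) XY(1) A(1)] .
      show "dist a c = R - ra" by (rule internally_tangentD[OF t omega_a(1) Omega(1)])
      show "E = w + r *\<^sub>R n" "F = a + ra *\<^sub>R n" using E(1) F(1) nw by simp_all
      show "n \<bullet> (a - w) = r - ra" using nw by (simp add: inner_diff_right)
    qed (use X omega_a(1) n(1) in auto)
  next
    assume A: "X \<in> closed_segment A B" "Y \<in> closed_segment A C"
      and t: "externally_tangent a ra c R" and kk: "opposite_side k (sphere w r) (sphere a ra)"
    obtain n b where n: "norm n = 1" "k = {x. n \<bullet> x = b}" "\<forall>x\<in>sphere w r. n \<bullet> x \<le> b"
      "\<forall>x\<in>sphere a ra. n \<bullet> x \<ge> b" using opposite_sideE[OF kk] .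
    note E = tangent_lineD[OF omega(5)[unfolded n(2)] n(1)]
      and F = tangent_lineD[OF k(2)[unfolded n(2)] n(1)]
    have "(- n) \<bullet> a \<le> - b"
      using n omega_a(1) by (intro sphere_center_le[of a ra]) auto
    then have nw: "b - n \<bullet> w = r" "b - n \<bullet> a = - ra"
      using E(2) F(2) sphere_center_le[OF n(3) _ n(1)] omega(1) omega_a(1) by auto
    obtain u where u: "0 \<le> u" "u \<le> 1" and A': "X = (1 - u) *\<^sub>R A + u *\<^sub>R B"
      using A(1) by (auto simp: in_segment)
    have "f \<bullet> X = (1 - u) * (f \<bullet> A) + u * (f \<bullet> B)" by (subst A') (simp add: inner_add_right)
    then have "f \<bullet> X - f \<bullet> B = (1 - u) * (f \<bullet> A - f \<bullet> B)" by algebra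
    also have "\<dots> \<ge> 0" using u f(4) by simp
    finally have X: "f \<bullet> X \<ge> f \<bullet> B" by simp
    show thesis
    proof (rule that[of "- ra" n])
      show "n1 \<bullet> (a - A) = - (- ra)"
        using tangent_same_angle[OF n1(1) omega_a(2)[unfolded n1(2)] n2(1)
            omega_a(3)[unfolded n2(2)] omega_a(1) n1(4) n2(3) A(2)] by simp
      show "n2 \<bullet> (a - A) = - (- ra)"
        using tangent_same_angle[OF n2(1) omega_a(3)[unfolded n2(2)] n1(1)
            omega_a(2)[unfolded n1(2)] omega_a(1) n2(4) n1(3) A(1)] by simp
      show "dist a c = R - - ra" using externally_tangentD[OF t omega_a(1) Omega(1)] by simp
      show "E = w + r *\<^sub>R n" "F = a + (- ra) *\<^sub>R n" using E(1) F(1) nw by simp_all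
      show "n \<bullet> (a - w) = r - - ra" using nw by (simp add: inner_diff_right)
    qed (use X omega_a(1) n(1) in auto)
  qed

  obtain n' b' where n': "norm n' = 1" "line_through D E = {x. n' \<bullet> x = b'}"
    "\<forall>x\<in>{T}. n' \<bullet> x \<le> b'" "\<forall>x\<in>{F}. n' \<bullet> x \<le> b'"
    using same_sideE[OF branch] .
  have DE: "D \<noteq> E"
  proof
    assume "D = E"
    \<comment> \<open>For \<open>D = E\<close> the affine hull degenerates to a point, whereas
      \<open>branch\<close> makes it a line.\<close>
    then have "{x. n' \<bullet> x = b'} = {D}" using n'(2) by simp
    then show False by (rule line_not_singleton[OF n'(1)])
  qed
  have b': "n' \<bullet> D = b'" "n' \<bullet> E = b'"
    using n'(2) mem_line_through[of D E] mem_line_through[of E D] by auto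

  \<comment> \<open>Coordinates along \<open>BC\<close> and its normal, with the midpoint of
    \<open>BC\<close> as origin\<close>
  define e where "e = perp f"
  define M where "M = (1/2) *\<^sub>R (B + C)"
  define x y where "x Z = e \<bullet> (Z - M)" and "y Z = f \<bullet> (Z - M)" for Z
  note frame = inner_frame[OF f(1), folded e_def]
  have ex: "e \<bullet> (Z - W) = x Z - x W" and fy: "f \<bullet> (Z - W) = y Z - y W" for Z W
    by (simp_all add: x_def y_def inner_diff_right)
  have xy: "u \<bullet> (Z - W) = (e \<bullet> u) * (x Z - x W) + (f \<bullet> u) * (y Z - y W)" for u Z W
    using frame[of u "Z - W"] by (simp only: ex fy)
  have dist: "(dist Z W)\<^sup>2 = (x Z - x W)\<^sup>2 + (y Z - y W)\<^sup>2" for Z W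
    using frame[of "Z - W" "Z - W"] unfolding dist_norm power2_norm_eq_inner
    by (simp add: ex fy power2_eq_square)
  have unit: "(e \<bullet> u)\<^sup>2 + (f \<bullet> u)\<^sup>2 = 1" if "norm u = 1" for u
    using frame[of u u] that by (simp add: norm_eq_1 power2_eq_square)
  have e: "e \<bullet> f = 0" "f \<bullet> f = 1" using f(1) by (simp_all add: e_def norm_eq_1)

  \<comment> \<open>The direction of \<open>e\<close> along \<open>BC\<close> is not fixed, so
    \<open>m\<close> may have either sign; only \<open>m \<noteq> 0\<close> is available.\<close>
  define m where "m = x C"
  have BC: "x B = - m" "x C = m" "y B = 0" "y C = 0"
    using f(3) by (simp_all add: m_def x_def y_def M_def algebra_simps inner_add_right inner_diff_right)
  have m: "m \<noteq> 0"
  proof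
    assume "m = 0"
    then have "dist B C = 0" using dist[of B C] BC by simp
    then show False using triangle by simp
  qed
  define h where "h = y c"
  have Rm: "(m + x c)\<^sup>2 + h\<^sup>2 = R\<^sup>2" "(m - x c)\<^sup>2 + h\<^sup>2 = R\<^sup>2"
    using dist[of c B] dist[of c C] Omega(2,3) BC by (simp_all add: h_def power2_commute add.commute)
  then have "m * x c = 0" by algebra
  then have c: "x c = 0" using m by simp
  with Rm have Rm: "R\<^sup>2 = m\<^sup>2 + h\<^sup>2" by simp

  \<comment> \<open>The circle \<open>\<omega>\<close> and its contact points \<open>D\<close> and
    \<open>T\<close>\<close>
  note D = tangent_lineD[OF omega(2)[unfolded f(2)] f(1)]
  have fw: "f \<bullet> B - f \<bullet> w = - r" using D(2) w by simp
  define d where "d = x D"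
  have "w = D + r *\<^sub>R f" using D(1) unfolding fw by simp
  then have w: "x w = d" "y w = r"
    using D(3) f(3) e by (simp_all add: d_def x_def y_def M_def inner_add_right inner_diff_right)
  have yD: "y D = 0"
    using D(3) f(3) by (simp add: y_def M_def inner_add_right inner_diff_right)
  obtain u where u: "0 \<le> u" "u \<le> 1" and Du: "D = (1 - u) *\<^sub>R B + u *\<^sub>R C"
    using omega(3) by (auto simp: in_segment)
  have "D - B = u *\<^sub>R (C - B)" using Du by (simp add: algebra_simps)
  then have "d + m = u * (2 * m)" using ex[of D B] ex[of C B] BC by (simp add: d_def)
  then have "m\<^sup>2 - d\<^sup>2 = (4 * m\<^sup>2) * (u * (1 - u))" by algebra
  also have "\<dots> \<ge> 0" using u by simp
  finally have dm: "d\<^sup>2 \<le> m\<^sup>2" by simp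

  note Tt = tangent_spheresD[OF omega(4) omega(1)]
  have wc: "(dist w c)\<^sup>2 = d\<^sup>2 + (r - h)\<^sup>2" using dist[of w c] by (simp add: w c h_def)
  have "d\<^sup>2 + (r - h)\<^sup>2 = (R + r)\<^sup>2 \<or> d\<^sup>2 + (r - h)\<^sup>2 = (R - r)\<^sup>2"
    using Tt(3) wc by auto
  note rK = circle_in_segment_coords[OF m Omega(1) Rm omega(1) dm this]
  have \<delta>: "norm (c - w) = R - r"
    using wc rK(2,4) by (simp add: dist_norm norm_minus_commute)
  obtain t where t: "T = w + t *\<^sub>R (c - w)" using Tt(2) by blast
  have "\<bar>t * (R - r)\<bar> = r" "\<bar>(1 - t) * (R - r)\<bar> = R"
  proof -
    have "norm (T - w) = r" "norm (c - T) = R"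
      using omega(4) by (auto simp: tangent_at_def dist_norm norm_minus_commute)
    moreover have "T - w = t *\<^sub>R (c - w)" "c - T = (1 - t) *\<^sub>R (c - w)"
      using t by (simp_all add: algebra_simps)
    ultimately show "\<bar>t * (R - r)\<bar> = r" "\<bar>(1 - t) * (R - r)\<bar> = R"
      using \<delta> rK(2) by (simp_all add: abs_mult)
  qed
  moreover have "(1 - t) * (R - r) = R - r - t * (R - r)" by algebra
  \<comment> \<open>Of the possible signs, \<open>0 < r < R\<close> leaves only the one where
    \<open>T\<close> lies beyond \<open>w\<close> on the ray from \<open>c\<close>.\<close>
  ultimately have tr: "t * (R - r) = - r" using omega(1) rK(2) by linarith
  then have "t < 0" using omega(1) rK(2) by (smt (verit) mult_nonneg_nonneg)
  have "T - w = t *\<^sub>R (c - w)" using t by simp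
  then have "x T - d = - t * d" "y T - r = t * (h - r)"
    using ex[of T w] ex[of c w] fy[of T w] fy[of c w] by (simp_all add: w c h_def)
  \<comment> \<open>Thus \<open>T - D\<close> is a positive multiple of \<open>(d, R - h)\<close>,
    the vector to \<open>D\<close> from the midpoint \<open>(0, h - R)\<close> of the arc of
    \<open>\<Omega>\<close> below \<open>BC\<close>.\<close>
  then have T: "x T - d = - t * d" "y T = - t * (R - h)" using tr by algebra+

  \<comment> \<open>The lines \<open>k\<close> and \<open>DE\<close> in coordinates\<close>
  define g g' p q where "g = e \<bullet> n" and "g' = f \<bullet> n" and "p = e \<bullet> n'" and "q = f \<bullet> n'"
  have Exy: "x E - d = r * g" "y E = r * (1 + g')"
    using ex[of E w] fy[of E w] by (simp_all add: E g_def g'_def w algebra_simps)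
  have g': "g' \<noteq> - 1"
  proof
    assume "g' = - 1"
    moreover from this have "g = 0" using unit[OF n] by (simp add: g_def g'_def)
    ultimately have "x E = x D" "y E = y D" using Exy yD by (simp_all add: d_def)
    then have "dist D E = 0" using dist[of D E] by simp
    then show False using DE by simp
  qed
  have pq: "p * g + q * (1 + g') = 0"
  proof -
    have "n' \<bullet> (E - D) = 0" using b' by (simp add: inner_diff_right)
    then have "p * (x E - x D) + q * (y E - y D) = 0" by (simp only: xy p_def q_def)
    then have "r * (p * g + q * (1 + g')) = 0"
      using Exy yD unfolding d_def by algebra
    then show ?thesis using omega(1) by simp
  qed
  have pT: "p * d + q * (R - h) \<le> 0"
  proof -
    have "n' \<bullet> (T - D) \<le> 0" using b' n'(3) by (simp add: inner_diff_right)
    then have "p * (x T - d) + q * y T \<le> 0" by (simp add: xy p_def q_def d_def yD)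
    then have "- t * (p * d + q * (R - h)) \<le> 0" unfolding T by (simp add: algebra_simps)
    then show ?thesis using \<open>t < 0\<close> by (simp add: mult_le_0_iff zero_le_mult_iff)
  qed
  have Fxy: "x F = x a + s * g" "y F = y a + s * g'"
    using ex[of F a] fy[of F a] by (simp_all add: F g_def g'_def)
  have pF: "p * (x a + s * g - d) + q * (y a + s * g') \<le> 0"
  proof -
    have "n' \<bullet> (F - D) \<le> 0" using b' n'(4) by (simp add: inner_diff_right)
    then show ?thesis by (simp add: xy p_def q_def d_def yD Fxy)
  qed
  have tang_k: "g * (x a - d) + g' * (y a - r) = r - s"
    using naw by (simp add: xy w g_def g'_def)
  have tang_\<Omega>: "(x a)\<^sup>2 + (y a - h)\<^sup>2 = (R - s)\<^sup>2"
    using dist[of a c] ac by (simp add: c h_def)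
  \<comment> \<open>The circle \<open>\<omega>\<^sub>a\<close> reaches a height
    \<open>\<ge> 0\<close> at \<open>X\<close>, hence
    \<open>y a + \<bar>s\<bar> \<ge> 0\<close>.\<close>
  have sgn: "y a + s \<ge> 0 \<or> y a - s \<ge> 0"
  proof -
    have "\<bar>f \<bullet> (X - a)\<bar> \<le> ra"
      using Cauchy_Schwarz_ineq2[of f "X - a"] XY(1) f(1)
      by (simp add: mem_sphere_norm del: mem_sphere)
    moreover have "y X \<ge> 0" using X fy[of X B] BC by (simp add: inner_diff_right)
    ultimately show ?thesis using s unfolding fy by linarith
  qed

  \<comment> \<open>The incenter and the sides \<open>AB\<close> and \<open>AC\<close>\<close>
  have yI: "y I = \<rho>" using \<rho>f fy[of I B] BC by simp
  have AB: "\<rho>\<^sup>2 * (y a + s) + 2 * \<rho> * (x I + m) * (x a + m) = (x I + m)\<^sup>2 * (y a - s)"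
    and AB_pos: "2 * m * (x I + m) > 0"
  proof -
    have "n1 \<bullet> (I - B) = \<rho>" "n1 \<bullet> (a - B) = - s" "n1 \<bullet> (C - B) > 0" "f \<bullet> (C - B) = 0"
      using \<rho>1 a1 n1(3,4) f(3) by (simp_all add: inner_diff_right)
    moreover have "n1 \<noteq> f" using n1(3) f(4) by auto
    ultimately show "\<rho>\<^sup>2 * (y a + s) + 2 * \<rho> * (x I + m) * (x a + m) = (x I + m)\<^sup>2 * (y a - s)"
      "2 * m * (x I + m) > 0"
      using second_tangent_inner[OF f(1) \<rho>f n1(1), of a s C, folded e_def] \<rho>
      by (simp_all add: ex fy BC)
  qed
  have AC: "\<rho>\<^sup>2 * (y a + s) + 2 * \<rho> * (x I - m) * (x a - m) = (x I - m)\<^sup>2 * (y a - s)"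
    and AC_pos: "- (2 * m) * (x I - m) > 0"
  proof -
    have "n2 \<bullet> (I - C) = \<rho>" "n2 \<bullet> (a - C) = - s" "n2 \<bullet> (B - C) > 0" "f \<bullet> (B - C) = 0"
      "f \<bullet> (I - C) = \<rho>"
      using \<rho>2 a2 n2(3,4) f(3) \<rho>f by (simp_all add: inner_diff_right)
    moreover have "n2 \<noteq> f" using n2(3) f(3,4) by auto
    ultimately show "\<rho>\<^sup>2 * (y a + s) + 2 * \<rho> * (x I - m) * (x a - m) = (x I - m)\<^sup>2 * (y a - s)"
      "- (2 * m) * (x I - m) > 0"
      using second_tangent_inner[OF f(1) _ n2(1), of I C \<rho> a s B, folded e_def] \<rho>
      by (simp_all add: ex fy BC)
  qed
  have xm: "(x I)\<^sup>2 < m\<^sup>2"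
  proof -
    \<comment> \<open>Multiplying the two sign conditions makes the sign of \<open>m\<close>
      irrelevant.\<close>
    have "(2 * m * (x I + m)) * (- (2 * m) * (x I - m)) > 0" using AB_pos AC_pos by (rule mult_pos_pos)
    also have "(2 * m * (x I + m)) * (- (2 * m) * (x I - m)) = (4 * m\<^sup>2) * (m\<^sup>2 - (x I)\<^sup>2)" by algebra
    finally show ?thesis using m by (simp add: zero_less_mult_iff)
  qed

  have chord: "(x I - d) * (1 + g') = \<rho> * g"
    by (rule incenter_on_chord_coords[OF m Rm rK(1) \<rho> xm AB AC tang_\<Omega> sgn rK(3)
          unit[OF n, folded g_def g'_def] g' tang_k unit[OF n'(1), folded p_def q_def] pq pT pF])

  have "n' \<bullet> (I - D) = p * (x I - d) + q * \<rho>" by (simp add: xy p_def q_def d_def yD yI)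
  \<comment> \<open>By \<open>chord\<close> the left side equals
    \<open>\<rho> * (p * g + q * (1 + g'))\<close>, which is zero by \<open>pq\<close>.\<close>
  moreover have "(1 + g') * (p * (x I - d) + q * \<rho>) = 0" using chord pq by algebra
  ultimately have "n' \<bullet> (I - D) = 0" using g' by (simp add: add_eq_0_iff)
  then have "I \<in> line_through D E" unfolding n'(2) using b' by (simp add: inner_diff_right)
  with DE show ?thesis by blast
qed

end
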